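(* Let $n\geq 4$. Among all unicyclic graphs on $n$ vertices, the pineapple graph $U_{n,3}^p$ has the maximum core index; that is, $F(G)\leq F(U_{n,3}^p)$ for every unicyclic graph $G$ on $n$ vertices.
   Context: All graphs are finite, simple and undirected. A unicyclic graph is a connected graph with the same number of vertices and edges. The pineapple graph $U_{n,3}^p$ is obtained from a triangle $C_3$ by attaching $n-3$ new pendant vertices to a single vertex of the triangle. A connected subgraph of a graph $G=(V,E)$ is a graph $(V',E')$ with $\emptyset\neq V'\subseteq V$, $E'\subseteq E$, every edge of $E'$ having both endpoints in $V'$, and $(V',E')$ connected; distinct pairs $(V',E')$ are counted separately. The core index $F(G)$ is the number of connected subgraphs of $G$. *)

theory Defs
  imports Main
begin

type_synonym 'a ugraph = "'a set \<times> 'a set set"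

abbreviation vertices :: "'a ugraph \<Rightarrow> 'a set" where
  "vertices G \<equiv> fst G"

abbreviation edges :: "'a ugraph \<Rightarrow> 'a set set" where
  "edges G \<equiv> snd G"

definition simple_graph :: "'a ugraph \<Rightarrow> bool" where
  "simple_graph G \<longleftrightarrow> finite (vertices G) \<and> (\<forall>e\<in>edges G. e \<subseteq> vertices G \<and> card e = 2)"

definition adjacency :: "'a ugraph \<Rightarrow> ('a \<times> 'a) set" where
  "adjacency G = {(u, v). {u, v} \<in> edges G}"

definition connected_graph :: "'a ugraph \<Rightarrow> bool" where
  "connected_graph G \<longleftrightarrow>
     vertices G \<noteq> {} \<and> (\<forall>u\<in>vertices G. \<forall>v\<in>vertices G. (u, v) \<in> (adjacency G)\<^sup>*)"

definition unicyclic :: "'a ugraph \<Rightarrow> bool" where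
  "unicyclic G \<longleftrightarrow>
     simple_graph G \<and> connected_graph G \<and> card (vertices G) = card (edges G)"

definition subgraph :: "'a ugraph \<Rightarrow> 'a ugraph \<Rightarrow> bool" where
  "subgraph H G \<longleftrightarrow>
     vertices H \<subseteq> vertices G \<and> edges H \<subseteq> edges G \<and> (\<forall>e\<in>edges H. e \<subseteq> vertices H)"

definition core_index :: "'a ugraph \<Rightarrow> nat" where
  "core_index G = card {H. subgraph H G \<and> connected_graph H}"

text \<open>The triangle has vertices 0, 1, 2, and the pendant vertices 3, ..., n - 1 are attached
  to 0. The definition is meaningful for \<open>n \<ge> 3\<close> only.\<close>

definition pineapple :: "nat \<Rightarrow> nat ugraph" where
  "pineapple n = ({0..<n}, {{0, 1}, {1, 2}, {0, 2}} \<union> {{0, i} | i. i \<in> {3..<n}})"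

end

theory Submission
  imports Defs
begin

text \<open>A connected subgraph is either a single vertex or is determined by its nonempty edge set, so
  for graphs with \<open>n\<close> vertices and \<open>n\<close> edges maximising the core index means minimising the number
  \<open>D\<close> of nonempty edge sets that are not connected. For a unicyclic graph \<open>D \<ge> 2\<^sup>n\<^sup>-\<^sup>3 - 1\<close>, with
  equality for the pineapple graph. The bound is proved by removing leaves, together with the bound
  \<open>2\<^sup>n\<^sup>-\<^sup>3\<close> for the number of edge sets that are not connected to a given vertex \<open>u\<close>: if \<open>v\<close> is a
  leaf attached to \<open>u\<close>, the latter edge sets of \<open>G - v\<close> become disconnected when the edge \<open>uv\<close> is
  added. A unicyclic graph without leaves is 2-regular by the handshake lemma; there the
  edge sets that contain an edge \<open>e\<close> but neither of its two neighbours suffice.\<close>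

text \<open>The vertex set \<open>\<Union>S\<close> is forced on a connected subgraph with edge set
  \<open>S\<close>, by \<open>connected_subgraph_vertices\<close>.\<close>

definition disconnected_edge_sets :: "'a set set \<Rightarrow> 'a set set set" where
  "disconnected_edge_sets E = {S. S \<subseteq> E \<and> S \<noteq> {} \<and> \<not> connected_graph (\<Union>S, S)}"

text \<open>The empty set is never a member, since \<open>({u}, {})\<close> is connected. In a
  graph, every nonempty set of edges that all miss \<open>u\<close> is one.\<close>

definition unrooted_edge_sets :: "'a \<Rightarrow> 'a set set \<Rightarrow> 'a set set set" where
  "unrooted_edge_sets u E = {S. S \<subseteq> E \<and> \<not> connected_graph (insert u (\<Union>S), S)}"

lemma finite_disconnected_edge_sets: "finite E \<Longrightarrow> finite (disconnected_edge_sets E)"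
  by (rule finite_subset[of _ "Pow E"]) (auto simp: disconnected_edge_sets_def)

lemma finite_unrooted_edge_sets: "finite E \<Longrightarrow> finite (unrooted_edge_sets u E)"
  by (rule finite_subset[of _ "Pow E"]) (auto simp: unrooted_edge_sets_def)

lemma inj_on_insert_element: "(\<And>S. S \<in> F \<Longrightarrow> x \<notin> S) \<Longrightarrow> inj_on (insert x) F"
  by (rule inj_onI) (metis insert_ident)

lemma simple_graph_finite_edges: "simple_graph G \<Longrightarrow> finite (edges G)"
  by (rule finite_subset[of _ "Pow (vertices G)"]) (auto simp: simple_graph_def)

section \<open>Connectivity: closed sets and leaves\<close>

lemma sym_adjacency: "sym (adjacency G)"
  by (auto simp: sym_def adjacency_def insert_commute)

lemma connected_graphI:
  assumes "r \<in> vertices G" and "\<And>v. v \<in> vertices G \<Longrightarrow> (v, r) \<in> (adjacency G)\<^sup>*"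
  shows "connected_graph G"
proof -
  have "(u, v) \<in> (adjacency G)\<^sup>*" if "u \<in> vertices G" "v \<in> vertices G" for u v
    using assms(2)[OF that(1)] symD[OF sym_rtrancl[OF sym_adjacency] assms(2)[OF that(2)]]
    by (rule rtrancl_trans)
  then show ?thesis using assms(1) by (auto simp: connected_graph_def)
qed

text \<open>No edge leaves \<open>B\<close>, so a walk starting in \<open>B\<close> stays there.
  Used contrapositively to refute connectedness, with \<open>B\<close> a single isolated vertex or
  an isolated edge.\<close>

lemma connected_graph_closed_set:
  assumes "connected_graph (W, S)" "x \<in> W" "y \<in> W" "x \<in> B"
    and "\<And>e. e \<in> S \<Longrightarrow> e \<subseteq> B \<or> e \<inter> B = {}"
  shows "y \<in> B"
proof -
  have "(x, y) \<in> (adjacency (W, S))\<^sup>*"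
    using assms by (auto simp: connected_graph_def)
  then show ?thesis
  proof (induction rule: rtrancl_induct)
    case base
    show ?case by fact
  next
    case (step y z)
    then have "{y, z} \<in> S" by (simp add: adjacency_def)
    then show ?case using step.IH assms(5)[of "{y, z}"] by auto
  qed
qed

text \<open>A walk can enter and leave \<open>v\<close> only through \<open>u\<close>, so visits to
  \<open>v\<close> can be cut out. Adjacency depends on the edges alone, which leaves
  \<open>W'\<close> free: it is \<open>V - {v}\<close> in one use and the ends of \<open>S\<close>
  together with a root in the others.\<close>

lemma connected_graph_remove_leaf:
  assumes "connected_graph (W, insert {u, v} S)" "v \<notin> \<Union>S"
    and "W' \<subseteq> W" "v \<notin> W'" "W' \<noteq> {}"
  shows "connected_graph (W', S)"
  unfolding connected_graph_def
proof (intro conjI ballI)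
  show "vertices (W', S) \<noteq> {}" using assms by simp
next
  fix x y assume "x \<in> vertices (W', S)" "y \<in> vertices (W', S)"
  then have x: "x \<noteq> v" and y: "y \<noteq> v" and xy: "x \<in> W" "y \<in> W" using assms by auto
  let ?A = "adjacency (W', S)"
  have "(x, y) \<in> (adjacency (W, insert {u, v} S))\<^sup>*"
    using assms(1) xy by (auto simp: connected_graph_def)
  \<comment> \<open>The walk is followed with \<open>v\<close> contracted into \<open>u\<close>, so
    that a step along \<open>{u, v}\<close> does not move.\<close>
  then have "(x, if y = v then u else y) \<in> ?A\<^sup>*"
  proof (induction rule: rtrancl_induct)
    case base
    show ?case using x by simp
  next
    case (step y z)
    then have "{y, z} = {u, v} \<or> {y, z} \<in> S" by (simp add: adjacency_def)
    then show ?case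
    proof
      assume "{y, z} = {u, v}"
      then show ?thesis using step.IH by (auto simp: doubleton_eq_iff split: if_splits)
    next
      assume e: "{y, z} \<in> S"
      then have "(y, z) \<in> ?A" and "y \<noteq> v" "z \<noteq> v"
        using assms(2) by (auto simp: adjacency_def)
      then show ?thesis using step.IH by (auto intro: rtrancl_into_rtrancl)
    qed
  qed
  then show "(x, y) \<in> ?A\<^sup>*" using y by simp
qed

section \<open>The core index in terms of edge sets\<close>

lemma connected_graph_without_edges_iff: "connected_graph (W, {}) \<longleftrightarrow> (\<exists>v. W = {v})"
proof -
  have "adjacency (W, {}) = {}" by (simp add: adjacency_def)
  then have "connected_graph (W, {}) \<longleftrightarrow> W \<noteq> {} \<and> (\<forall>u\<in>W. \<forall>v\<in>W. u = v)"
    by (simp add: connected_graph_def)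
  then show ?thesis by blast
qed

lemma connected_subgraph_vertices:
  assumes "connected_graph (W, S)" "S \<noteq> {}" "\<forall>e\<in>S. e \<subseteq> W \<and> card e = 2"
  shows "W = \<Union>S"
proof
  show "W \<subseteq> \<Union>S"
  proof (rule ccontr)
    assume "\<not> W \<subseteq> \<Union>S"
    then obtain x where x: "x \<in> W" "x \<notin> \<Union>S" by blast
    obtain e where e: "e \<in> S" using assms(2) by blast
    then obtain y where "y \<in> e" using assms(3) by fastforce
    then have "y \<in> W" "y \<noteq> x" using e x assms(3) by blast+
    then show False
      using connected_graph_closed_set[OF assms(1) x(1), of y "{x}"] x by blast
  qed
qed (use assms(3) in blast)

text \<open>The summand \<open>card (vertices G)\<close> stands for the one-vertex subgraphs. The
  edge sets split into the connected nonempty ones, the disconnected ones and the empty set, which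
  is the \<open>1\<close> on the left.\<close>

lemma core_index_plus_disconnected:
  assumes "simple_graph G"
  shows "core_index G + card (disconnected_edge_sets (edges G)) + 1
    = card (vertices G) + 2 ^ card (edges G)"
proof -
  let ?V = "vertices G" and ?E = "edges G"
  let ?C = "{S. S \<subseteq> ?E \<and> S \<noteq> {} \<and> connected_graph (\<Union>S, S)}"
  let ?D = "disconnected_edge_sets ?E"
  have finE: "finite ?E" by (rule simple_graph_finite_edges) fact
  have finV: "finite ?V" and E: "\<And>e. e \<in> ?E \<Longrightarrow> e \<subseteq> ?V \<and> card e = 2"
    using assms by (auto simp: simple_graph_def)
  have finC: "finite ?C" by (rule finite_subset[of _ "Pow ?E"]) (use finE in auto)
  have "{H. subgraph H G \<and> connected_graph H} = (\<lambda>v. ({v}, {})) ` ?V \<union> (\<lambda>S. (\<Union>S, S)) ` ?C"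
  proof (intro equalityI subsetI)
    fix H assume "H \<in> {H. subgraph H G \<and> connected_graph H}"
    then obtain W S where H: "H = (W, S)" and sub: "W \<subseteq> ?V" "S \<subseteq> ?E" "\<forall>e\<in>S. e \<subseteq> W"
      and con: "connected_graph (W, S)"
      by (cases H) (auto simp: subgraph_def)
    show "H \<in> (\<lambda>v. ({v}, {})) ` ?V \<union> (\<lambda>S. (\<Union>S, S)) ` ?C"
    proof (cases "S = {}")
      case True
      then show ?thesis using con sub H by (auto simp: connected_graph_without_edges_iff)
    next
      case False
      then have "W = \<Union>S" using connected_subgraph_vertices[OF con] sub E by blast
      then show ?thesis using con sub H False by auto
    qed
  next
    fix H assume "H \<in> (\<lambda>v. ({v}, {})) ` ?V \<union> (\<lambda>S. (\<Union>S, S)) ` ?C"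
    then show "H \<in> {H. subgraph H G \<and> connected_graph H}"
      using E by (auto simp: subgraph_def connected_graph_without_edges_iff) blast
  qed
  moreover have "card ((\<lambda>v. ({v}, {})) ` ?V \<union> (\<lambda>S. (\<Union>S, S)) ` ?C) = card ?V + card ?C"
    using finV finC
    by (subst card_Un_disjoint) (auto simp: card_image inj_on_def)
  ultimately have "core_index G = card ?V + card ?C" by (simp add: core_index_def)
  moreover have "card ?C + card ?D + 1 = 2 ^ card ?E"
  proof -
    have "Pow ?E = insert {} (?C \<union> ?D)" by (auto simp: disconnected_edge_sets_def)
    moreover have "{} \<notin> ?C \<union> ?D" by (auto simp: disconnected_edge_sets_def)
    moreover have "?C \<inter> ?D = {}" by (auto simp: disconnected_edge_sets_def)
    ultimately have "card (Pow ?E) = Suc (card ?C + card ?D)"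
      using finC finite_disconnected_edge_sets[OF finE] by (simp add: card_Un_disjoint)
    then show ?thesis using finE by (simp add: card_Pow)
  qed
  ultimately show ?thesis by simp
qed

section \<open>Leaf removal and direct counts of edge sets\<close>

lemma unicyclic_remove_leaf:
  assumes "unicyclic (V, E)" "{u, v} \<in> E" "u \<noteq> v" "v \<notin> \<Union>(E - {{u, v}})"
  shows "unicyclic (V - {v}, E - {{u, v}})"
proof -
  have finE: "finite E" and finV: "finite V" and uv: "u \<in> V" "v \<in> V"
    using assms simple_graph_finite_edges[of "(V, E)"]
    by (auto simp: unicyclic_def simple_graph_def)
  have "connected_graph (V - {v}, E - {{u, v}})"
    by (rule connected_graph_remove_leaf[of V u v])
      (use assms uv in \<open>auto simp: unicyclic_def insert_absorb\<close>)
  then show ?thesis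
    using assms finE finV uv by (auto simp: unicyclic_def simple_graph_def card_Diff_singleton)
qed

text \<open>The two summands count disconnected sets without and with the edge
  \<open>{u, v}\<close>. Its presence makes \<open>u\<close> a vertex of the graph, which is why the
  sets in the second summand are rooted at \<open>u\<close>.\<close>

lemma leaf_disconnected_edge_sets:
  assumes "finite E" "{u, v} \<in> E" "u \<noteq> v" "v \<notin> \<Union>(E - {{u, v}})"
  shows "card (disconnected_edge_sets (E - {{u, v}})) + card (unrooted_edge_sets u (E - {{u, v}}))
    \<le> card (disconnected_edge_sets E)"
proof -
  let ?e = "{u, v}"
  let ?E = "E - {?e}"
  have v: "v \<notin> \<Union>S" if "S \<subseteq> ?E" for S using that assms(4) by blast
  have "insert ?e S \<in> disconnected_edge_sets E" if "S \<in> unrooted_edge_sets u ?E" for S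
  proof -
    have S: "S \<subseteq> ?E" "\<not> connected_graph (insert u (\<Union>S), S)"
      using that by (auto simp: unrooted_edge_sets_def)
    then have "\<not> connected_graph (\<Union>(insert ?e S), insert ?e S)"
      using connected_graph_remove_leaf[of "\<Union>(insert ?e S)" u v S "insert u (\<Union>S)"]
        v[OF S(1)] assms(3) by auto
    then show ?thesis using S assms(2) by (auto simp: disconnected_edge_sets_def)
  qed
  then have "disconnected_edge_sets ?E \<union> insert ?e ` unrooted_edge_sets u ?E
      \<subseteq> disconnected_edge_sets E"
    by (auto simp: disconnected_edge_sets_def)
  then have "card (disconnected_edge_sets ?E \<union> insert ?e ` unrooted_edge_sets u ?E)
      \<le> card (disconnected_edge_sets E)"
    by (intro card_mono finite_disconnected_edge_sets assms)
  moreover have "inj_on (insert ?e) (unrooted_edge_sets u ?E)"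
    by (rule inj_on_insert_element) (auto simp: unrooted_edge_sets_def)
  moreover have "disconnected_edge_sets ?E \<inter> insert ?e ` unrooted_edge_sets u ?E = {}"
    by (auto simp: disconnected_edge_sets_def)
  ultimately show ?thesis
    using assms(1) by (simp add: card_Un_disjoint card_image finite_disconnected_edge_sets
        finite_unrooted_edge_sets)
qed

text \<open>A pendant edge cannot help to join other vertices to \<open>w\<close>, so each unrooted
  \<open>S\<close> yields two: \<open>S\<close> itself and \<open>S\<close> with the edge
  added.\<close>

lemma leaf_unrooted_edge_sets:
  assumes "finite E" "{u, v} \<in> E" "v \<notin> \<Union>(E - {{u, v}})" "w \<noteq> v"
  shows "2 * card (unrooted_edge_sets w (E - {{u, v}})) \<le> card (unrooted_edge_sets w E)"
proof -
  let ?e = "{u, v}"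
  let ?E = "E - {?e}"
  let ?R = "unrooted_edge_sets w ?E"
  have v: "v \<notin> \<Union>S" if "S \<subseteq> ?E" for S using that assms(3) by blast
  have "insert ?e S \<in> unrooted_edge_sets w E" if "S \<in> ?R" for S
  proof -
    have S: "S \<subseteq> ?E" "\<not> connected_graph (insert w (\<Union>S), S)"
      using that by (auto simp: unrooted_edge_sets_def)
    then have "\<not> connected_graph (insert w (\<Union>(insert ?e S)), insert ?e S)"
      using connected_graph_remove_leaf[of "insert w (\<Union>(insert ?e S))" u v S "insert w (\<Union>S)"]
        v[OF S(1)] assms(4) by auto
    then show ?thesis using S assms(2) by (auto simp: unrooted_edge_sets_def)
  qed
  then have "?R \<union> insert ?e ` ?R \<subseteq> unrooted_edge_sets w E"
    by (auto simp: unrooted_edge_sets_def)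
  then have "card (?R \<union> insert ?e ` ?R) \<le> card (unrooted_edge_sets w E)"
    by (intro card_mono finite_unrooted_edge_sets assms)
  moreover have "inj_on (insert ?e) ?R"
    by (rule inj_on_insert_element) (auto simp: unrooted_edge_sets_def)
  moreover have "?R \<inter> insert ?e ` ?R = {}"
    by (auto simp: unrooted_edge_sets_def)
  ultimately show ?thesis
    using assms(1) by (simp add: card_Un_disjoint card_image finite_unrooted_edge_sets)
qed

text \<open>Any nonempty set of edges avoiding \<open>u\<close> leaves the root isolated. The
  \<open>1\<close> makes up for the empty set.\<close>

lemma card_unrooted_edge_sets_ge:
  assumes "finite E" "{} \<notin> E" "card {e \<in> E. u \<in> e} = d"
  shows "2 ^ (card E - d) \<le> card (unrooted_edge_sets u E) + 1"
proof -
  let ?N = "{e \<in> E. u \<in> e}"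
  have "Pow (E - ?N) - {{}} \<subseteq> unrooted_edge_sets u E"
  proof
    fix S assume "S \<in> Pow (E - ?N) - {{}}"
    then have S: "S \<subseteq> E" "u \<notin> \<Union>S" and "S \<noteq> {}" by auto
    then obtain f where "f \<in> S" "f \<noteq> {}" using assms(2) by (metis all_not_in_conv subsetD)
    then obtain x where x: "x \<in> \<Union>S" by blast
    have "\<not> connected_graph (insert u (\<Union>S), S)"
      using connected_graph_closed_set[of "insert u (\<Union>S)" S u x "{u}"] S x by blast
    then show "S \<in> unrooted_edge_sets u E" using S by (simp add: unrooted_edge_sets_def)
  qed
  then have "card (Pow (E - ?N) - {{}}) \<le> card (unrooted_edge_sets u E)"
    by (intro card_mono finite_unrooted_edge_sets assms)
  moreover have "card (Pow (E - ?N)) = 2 ^ (card E - d)"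
    using assms by (simp add: card_Pow card_Diff_subset)
  ultimately show ?thesis using assms(1) by (simp add: card_Diff_singleton)
qed

text \<open>Adding to \<open>e\<close> a nonempty set of edges disjoint from it makes
  \<open>e\<close> a component of its own. The \<open>1\<close> makes up for the empty choice, and
  \<open>d\<close> counts \<open>e\<close> itself too.\<close>

lemma card_disconnected_edge_sets_ge:
  assumes "finite E" "{} \<notin> E" "e \<in> E" "card {f \<in> E. f \<inter> e \<noteq> {}} = d"
  shows "2 ^ (card E - d) \<le> card (disconnected_edge_sets E) + 1"
proof -
  let ?N = "{f \<in> E. f \<inter> e \<noteq> {}}"
  let ?P = "Pow (E - ?N) - {{}}"
  have "insert e ` ?P \<subseteq> disconnected_edge_sets E"
  proof
    fix T assume "T \<in> insert e ` ?P"
    then obtain S where T: "T = insert e S" and S: "S \<subseteq> E" "\<And>f. f \<in> S \<Longrightarrow> f \<inter> e = {}"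
      and "S \<noteq> {}" by auto
    then obtain f where "f \<in> S" "f \<noteq> {}" using assms(2) by (metis all_not_in_conv subsetD)
    then obtain y where y: "y \<in> \<Union>S" by blast
    obtain x where x: "x \<in> e" using assms(2,3) by (metis all_not_in_conv)
    have "\<not> connected_graph (\<Union>T, T)"
      using connected_graph_closed_set[of "\<Union>T" T x y e] S x y unfolding T by blast
    then show "T \<in> disconnected_edge_sets E"
      using S assms(3) by (auto simp: disconnected_edge_sets_def T)
  qed
  then have "card (insert e ` ?P) \<le> card (disconnected_edge_sets E)"
    by (intro card_mono finite_disconnected_edge_sets assms)
  moreover have "inj_on (insert e) ?P"
    by (rule inj_on_insert_element) (use assms(2,3) in auto)
  moreover have "card (Pow (E - ?N)) = 2 ^ (card E - d)"
    using assms by (simp add: card_Pow card_Diff_subset)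
  ultimately show ?thesis using assms(1) by (simp add: card_image card_Diff_singleton)
qed

section \<open>Degrees in unicyclic graphs and the lower bounds\<close>

lemma sum_degrees:
  assumes "simple_graph (V, E)"
  shows "(\<Sum>v\<in>V. card {e \<in> E. v \<in> e}) = 2 * card E"
proof (rule sum_multicount)
  show "\<forall>e\<in>E. card {v \<in> V. v \<in> e} = 2"
  proof
    fix e assume "e \<in> E"
    then have "{v \<in> V. v \<in> e} = e" "card e = 2" using assms by (auto simp: simple_graph_def)
    then show "card {v \<in> V. v \<in> e} = 2" by simp
  qed
qed (use assms simple_graph_finite_edges[OF assms] in \<open>auto simp: simple_graph_def\<close>)

text \<open>Having as many edges as vertices rules out the one-vertex graph: some edge exists, and
  an isolated vertex could not reach its ends.\<close>

lemma unicyclic_degree_pos: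
  assumes "unicyclic (V, E)" "v \<in> V"
  shows "0 < card {e \<in> E. v \<in> e}"
proof (rule ccontr)
  assume "\<not> 0 < card {e \<in> E. v \<in> e}"
  have sg: "simple_graph (V, E)" and con: "connected_graph (V, E)" and card: "card V = card E"
    using assms by (auto simp: unicyclic_def)
  have finE: "finite E" using simple_graph_finite_edges[OF sg] by simp
  with \<open>\<not> 0 < card {e \<in> E. v \<in> e}\<close> have v: "v \<notin> \<Union>E" by auto
  have "card V > 0" using sg assms(2) by (auto simp: simple_graph_def card_gt_0_iff)
  then obtain e where e: "e \<in> E" using card by fastforce
  then have "e \<subseteq> V" "card e = 2" using sg by (auto simp: simple_graph_def)
  then obtain y where "y \<in> e" "y \<in> V" by (auto simp: card_2_iff)
  then have "y \<in> {v}" using connected_graph_closed_set[OF con assms(2), of y "{v}"] v by blast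
  then show False using v e \<open>y \<in> e\<close> by blast
qed

text \<open>The average degree is exactly 2 and no degree is below 2, so none is above.\<close>

lemma unicyclic_leafless_2_regular:
  assumes "unicyclic (V, E)" "\<And>v. v \<in> V \<Longrightarrow> card {e \<in> E. v \<in> e} \<noteq> 1" "v \<in> V"
  shows "card {e \<in> E. v \<in> e} = 2"
proof -
  have ge: "2 \<le> card {e \<in> E. w \<in> e}" if "w \<in> V" for w
    using unicyclic_degree_pos[OF assms(1) that] assms(2)[OF that] by linarith
  have fin: "finite V" using assms by (auto simp: unicyclic_def simple_graph_def)
  have "(\<Sum>w\<in>V. card {e \<in> E. w \<in> e}) = (\<Sum>w\<in>V. 2)"
    using sum_degrees[of V E] assms by (simp add: unicyclic_def)
  then show ?thesis
    using ge sum_strict_mono_ex1[OF fin, of "\<lambda>_. 2" "\<lambda>w. card {e \<in> E. w \<in> e}"] assms(3)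
    by (metis (no_types, lifting) le_neq_implies_less less_irrefl)
qed

text \<open>The bounds are proved together because the first one for a graph with a leaf uses both
  for the smaller graph. Multiplied out by 8 they involve no subtraction, and removing a leaf halves
  the left-hand side.\<close>

lemma unicyclic_edge_set_bounds:
  assumes "unicyclic (V, E)"
  shows "2 ^ card V \<le> 8 * (card (disconnected_edge_sets E) + 1)
    \<and> (\<forall>w\<in>V. 2 ^ card V \<le> 8 * card (unrooted_edge_sets w E)) \<and> 3 \<le> card V"
  using assms
proof (induction "card V" arbitrary: V E rule: less_induct)
  case less
  have sg: "simple_graph (V, E)" and card: "card E = card V"
    using less.prems by (auto simp: unicyclic_def)
  have finV: "finite V" and E: "\<And>e. e \<in> E \<Longrightarrow> e \<subseteq> V \<and> card e = 2"
    using sg by (auto simp: simple_graph_def)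
  have finE: "finite E" using simple_graph_finite_edges[OF sg] by simp
  have ne: "{} \<notin> E" using E by fastforce
  show ?case
  proof (cases "\<exists>v\<in>V. card {e \<in> E. v \<in> e} = 1")
    case True
    then obtain v e where v: "v \<in> V" "card {e \<in> E. v \<in> e} = 1" "{e \<in> E. v \<in> e} = {e}"
      by (metis card_1_singletonE)
    then have e: "e \<in> E" "v \<in> e" by auto
    then obtain u where u: "e = {u, v}" "u \<noteq> v"
      using E[of e] by (auto simp: card_2_iff insert_commute)
    let ?V = "V - {v}" and ?E = "E - {{u, v}}"
    have leaf: "v \<notin> \<Union>?E" and uv: "{u, v} \<in> E" "u \<in> ?V" using v(3) u e E[of e] by auto
    have uni: "unicyclic (?V, ?E)"
      by (rule unicyclic_remove_leaf[OF less.prems uv(1) u(2) leaf])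
    have cV: "card V = Suc (card ?V)" using finV v(1) by (metis card.remove)
    then have IH: "2 ^ card ?V \<le> 8 * (card (disconnected_edge_sets ?E) + 1)"
        "\<And>w. w \<in> ?V \<Longrightarrow> 2 ^ card ?V \<le> 8 * card (unrooted_edge_sets w ?E)" "3 \<le> card ?V"
      using less.hyps[OF _ uni] by auto
    \<comment> \<open>Each of the two induction hypotheses supplies one half of
      \<open>2 ^ card V\<close>.\<close>
    have "2 ^ card V \<le> 8 * (card (disconnected_edge_sets E) + 1)"
      using leaf_disconnected_edge_sets[OF finE uv(1) u(2) leaf] IH(1) IH(2)[OF uv(2)]
      unfolding cV power_Suc by simp
    moreover have "2 ^ card V \<le> 8 * card (unrooted_edge_sets w E)" if "w \<in> V" for w
    proof (cases "w = v")
      case True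
      \<comment> \<open>The root is the removed leaf, so the induction hypothesis does not apply to
        it. Its degree 1 gives \<open>2 ^ card ?V - 1\<close> sets, well above the required quarter
        of \<open>2 ^ card ?V\<close> once \<open>card ?V\<close> is at least 3.\<close>
      have "2 ^ card ?V \<le> card (unrooted_edge_sets w E) + 1"
        using card_unrooted_edge_sets_ge[OF finE ne v(2)] True by (simp add: card cV)
      moreover have "(2::nat) ^ 3 \<le> 2 ^ card ?V" by (rule power_increasing) (use IH(3) in auto)
      ultimately show ?thesis unfolding cV power_Suc by simp
    next
      case False
      then show ?thesis
        using leaf_unrooted_edge_sets[OF finE uv(1) leaf False] IH(2)[of w] that
        unfolding cV power_Suc by simp
    qed
    ultimately show ?thesis using IH(3) cV by simp
  next
    case False
    then have deg: "card {e \<in> E. v \<in> e} = 2" if "v \<in> V" for v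
      using unicyclic_leafless_2_regular[OF less.prems _ that] by blast
    have "V \<noteq> {}" using less.prems by (auto simp: unicyclic_def connected_graph_def)
    then have "card E > 0" using finV card by (simp add: card_gt_0_iff)
    then obtain e where e: "e \<in> E" by fastforce
    then obtain x y where xy: "e = {x, y}" "x \<noteq> y" "x \<in> V" "y \<in> V"
      using E[of e] by (auto simp: card_2_iff)
    \<comment> \<open>Two edges meet each end of \<open>e\<close> and only \<open>e\<close> meets
      both, so \<open>2 + 2 - 1 = 3\<close> edges meet \<open>e\<close>. This gives the exponent
      \<open>card V - 3\<close>.\<close>
    have eq: "f = e" if "f \<in> E" "x \<in> f" "y \<in> f" for f
    proof -
      have "e \<subseteq> f" "card e = card f" "finite f"
        using that xy E[of f] E[of e] e by (auto intro: finite_subset[OF _ finV])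
      then show ?thesis using card_subset_eq by metis
    qed
    have "x \<in> e" "y \<in> e" using xy(1) by auto
    then have Int: "{f \<in> E. x \<in> f} \<inter> {f \<in> E. y \<in> f} = {e}" using e eq by blast
    have Un: "{f \<in> E. f \<inter> e \<noteq> {}} = {f \<in> E. x \<in> f} \<union> {f \<in> E. y \<in> f}"
      unfolding xy(1) by auto
    have N: "card {f \<in> E. f \<inter> e \<noteq> {}} = 3"
      using card_Un_Int[of "{f \<in> E. x \<in> f}" "{f \<in> E. y \<in> f}"] finE deg[OF xy(3)] deg[OF xy(4)]
      unfolding Un Int by simp
    have "card {f \<in> E. f \<inter> e \<noteq> {}} \<le> card E" by (rule card_mono) (use finE in auto)
    then obtain k where k: "card V = k + 3" using N card by (metis add.commute le_Suc_ex)
    have "2 ^ k \<le> card (disconnected_edge_sets E) + 1"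
      using card_disconnected_edge_sets_ge[OF finE ne e N] by (simp add: card k)
    \<comment> \<open>Degree 2 gives \<open>2 * 2 ^ k - 1\<close> sets, which is at least
      \<open>2 ^ k\<close> because \<open>2 ^ k\<close> is at least 1.\<close>
    moreover have "2 * 2 ^ k \<le> card (unrooted_edge_sets w E) + 1" if "w \<in> V" for w
      using card_unrooted_edge_sets_ge[OF finE ne deg[OF that]] by (simp add: card k)
    moreover have "(1::nat) \<le> 2 ^ k" by simp
    ultimately show ?thesis unfolding k by (fastforce simp: power_add)
  qed
qed

section \<open>The pineapple graph as a star at \<open>0\<close> with the extra edge
  \<open>{1, 2}\<close>\<close>

lemma pineapple_edges:
  assumes "n \<ge> 3"
  shows "edges (pineapple n) = insert {1, 2} ((\<lambda>i. {0, i}) ` {1..<n})"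
proof -
  have "{1..<n} = insert 1 (insert 2 {3..<n})" using assms by auto
  then show ?thesis by (auto simp: pineapple_def)
qed

lemma card_pineapple_edges:
  assumes "n \<ge> 3"
  shows "card (edges (pineapple n)) = n"
proof -
  have "inj_on (\<lambda>i::nat. {0, i}) {1..<n}" by (auto simp: inj_on_def doubleton_eq_iff)
  moreover have "{1, 2} \<notin> (\<lambda>i::nat. {0, i}) ` {1..<n}" by (auto simp: doubleton_eq_iff)
  ultimately show ?thesis using assms by (simp add: pineapple_edges card_image)
qed

lemma unicyclic_pineapple:
  assumes "n \<ge> 3"
  shows "unicyclic (pineapple n)"
proof -
  have V: "vertices (pineapple n) = {0..<n}" by (simp add: pineapple_def)
  have "simple_graph (pineapple n)"
    using assms by (auto simp: simple_graph_def V pineapple_edges)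
  moreover have "connected_graph (pineapple n)"
  proof (rule connected_graphI[of 0])
    show "0 \<in> vertices (pineapple n)" using assms by (simp add: V)
  next
    fix v assume "v \<in> vertices (pineapple n)"
    then have "v = 0 \<or> {v, 0} \<in> edges (pineapple n)"
      using assms by (cases "v = 0") (auto simp: V pineapple_edges insert_commute)
    then show "(v, 0) \<in> (adjacency (pineapple n))\<^sup>*" by (auto simp: adjacency_def)
  qed
  ultimately show ?thesis
    using card_pineapple_edges[OF assms] by (simp add: unicyclic_def V)
qed

text \<open>Star edges always hang together at \<open>0\<close>. The last assumption excludes the
  only obstruction: \<open>{1, 2}\<close> accompanied by other edges, none of which meets
  it.\<close>

lemma pineapple_connected_edge_set:
  assumes "n \<ge> 3" "S \<subseteq> edges (pineapple n)" "S \<noteq> {}"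
    and "{1, 2} \<notin> S \<or> {0, 1} \<in> S \<or> {0, 2} \<in> S \<or> S = {{1, 2}}"
  shows "connected_graph (\<Union>S, S)"
proof (cases "S = {{1, 2}}")
  case True
  show ?thesis
    by (rule connected_graphI[of 1]) (auto simp: True adjacency_def insert_commute)
next
  case False
  let ?A = "adjacency (\<Union>S, S)"
  have A: "(x, y) \<in> ?A" if "{x, y} \<in> S" for x y using that by (simp add: adjacency_def)
  have S: "e = {1, 2} \<or> (\<exists>i. e = {0, i})" if "e \<in> S" for e
    using that assms(1,2) by (auto simp: pineapple_edges)
  show ?thesis
  proof (rule connected_graphI[of 0])
    obtain e where "e \<in> S" using assms(3) by blast
    then show "0 \<in> vertices (\<Union>S, S)" using S[of e] assms(4) False by auto
  next
    fix v assume "v \<in> vertices (\<Union>S, S)"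
    then obtain e where e: "e \<in> S" "v \<in> e" by auto
    from S[OF e(1)] show "(v, 0) \<in> ?A\<^sup>*"
    proof
      assume e12: "e = {1, 2}"
      then have 12: "(1, 2) \<in> ?A" "(2, 1) \<in> ?A" using A e by (auto simp: insert_commute)
      \<comment> \<open>One end of \<open>{1, 2}\<close> is adjacent to \<open>0\<close>; the other
        reaches \<open>0\<close> through it.\<close>
      have "(1, 0) \<in> ?A \<or> (2, 0) \<in> ?A"
        using assms(4) False e e12 A by (auto simp: insert_commute)
      then have "(1, 0) \<in> ?A\<^sup>* \<and> (2, 0) \<in> ?A\<^sup>*"
        using 12 by (meson r_into_rtrancl converse_rtrancl_into_rtrancl)
      then show ?thesis using e e12 by auto
    next
      assume "\<exists>i. e = {0, i}"
      then show ?thesis using e A[of v 0] by (auto simp: insert_commute)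
    qed
  qed
qed

text \<open>With \<open>?T\<close> the triangle, a disconnected set consists of
  \<open>{1, 2}\<close> and a nonempty set of pendant edges, of which there are
  \<open>n - 3\<close>. This meets the lower bound for unicyclic graphs.\<close>

lemma card_disconnected_edge_sets_pineapple:
  assumes "n \<ge> 3"
  shows "8 * (card (disconnected_edge_sets (edges (pineapple n))) + 1) \<le> 2 ^ n"
proof -
  let ?E = "edges (pineapple n)" and ?T = "{{1, 2}, {0, 1}, {0, 2}} :: nat set set"
  have finE: "finite ?E" using assms by (simp add: pineapple_edges)
  have T: "?T \<subseteq> ?E" using assms by (auto simp: pineapple_edges)
  have cT: "card ?T = 3" by (simp add: doubleton_eq_iff)
  have "disconnected_edge_sets ?E \<subseteq> insert {1, 2} ` (Pow (?E - ?T) - {{}})"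
  proof
    fix S assume "S \<in> disconnected_edge_sets ?E"
    then have S: "S \<subseteq> ?E" "S \<noteq> {}" "\<not> connected_graph (\<Union>S, S)"
      by (auto simp: disconnected_edge_sets_def)
    then have *: "{1, 2} \<in> S" "{0, 1} \<notin> S" "{0, 2} \<notin> S" "S \<noteq> {{1, 2}}"
      using pineapple_connected_edge_set[OF assms S(1,2)] by auto
    then have "S = insert {1, 2} (S - {{1, 2}})" "S - {{1, 2}} \<in> Pow (?E - ?T) - {{}}"
      using S(1) by auto
    then show "S \<in> insert {1, 2} ` (Pow (?E - ?T) - {{}})" by (rule image_eqI)
  qed
  then have "card (disconnected_edge_sets ?E) \<le> card (Pow (?E - ?T) - {{}})"
    using finE by (intro surj_card_le) auto
  also have "\<dots> = 2 ^ (n - 3) - 1"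
    using finE T cT card_pineapple_edges[OF assms]
    by (simp add: card_Diff_singleton card_Pow card_Diff_subset)
  \<comment> \<open>The truncated subtraction of 1 is exact because the power is positive.\<close>
  finally have "card (disconnected_edge_sets ?E) + 1 \<le> 2 ^ (n - 3)"
    by (metis Suc_eq_plus1 Suc_le_eq Suc_pred' le_imp_less_Suc zero_less_numeral zero_less_power)
  moreover have "(2::nat) ^ n = 8 * 2 ^ (n - 3)"
    using assms power_add[of "2::nat" 3 "n - 3"] by simp
  ultimately show ?thesis by simp
qed

theorem theorem4p6:
  fixes n :: nat
  assumes "n \<ge> 4"
  shows "unicyclic (pineapple n) \<and> card (vertices (pineapple n)) = n \<and>
    (\<forall>G :: 'a ugraph. unicyclic G \<and> card (vertices G) = n
       \<longrightarrow> core_index G \<le> core_index (pineapple n))"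
proof (intro conjI allI impI)
  have n: "n \<ge> 3" using assms by simp
  show uni: "unicyclic (pineapple n)" by (rule unicyclic_pineapple[OF n])
  show cV: "card (vertices (pineapple n)) = n" by (simp add: pineapple_def)
  fix G :: "'a ugraph"
  assume G: "unicyclic G \<and> card (vertices G) = n"
  let ?D = "card (disconnected_edge_sets (edges G))"
    and ?P = "card (disconnected_edge_sets (edges (pineapple n)))"
  \<comment> \<open>Both sides are compared with \<open>2 ^ n\<close>. Since core index and
    disconnected sets have the same total in both graphs, fewer disconnected sets mean a larger core
    index.\<close>
  have "8 * (?P + 1) \<le> 8 * (?D + 1)"
    using card_disconnected_edge_sets_pineapple[OF n]
      unicyclic_edge_set_bounds[of "vertices G" "edges G"] G by simp
  moreover have "core_index G + ?D + 1 = n + 2 ^ n"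
    using core_index_plus_disconnected[of G] G by (simp add: unicyclic_def)
  moreover have "core_index (pineapple n) + ?P + 1 = n + 2 ^ n"
    using core_index_plus_disconnected[of "pineapple n"] uni cV by (simp add: unicyclic_def)
  ultimately show "core_index G \<le> core_index (pineapple n)" by simp
qed

end
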